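(* Let $p\in(0,1)$ be fixed. For each $n\ge 1$, let $\pi=\pi_{n,p}$ be the stationary distribution on $\{0,1,\dots,n\}$ of the Markov chain $(n_1^{(\ell)})_{\ell\ge 1}$ of sizes of community $1$ under the LECS prior with fixed retention probability $p$ and $k=2$ communities on $n$ nodes, and let $$C_{n,p}=\left[\sum_{j=0}^n(1-p^{j+1})(1-p^{n-j+1})\right]^{-1}.$$ Suppose that $(\eta_n)$ is a sequence with $\eta_n\to\infty$ and $\eta_n=o(n)$ as $n\to\infty$, and define $I_n=[\eta_n,n-\eta_n]$. Then, as $n\to\infty$, $$\sup_{i\in I_n}\left|\frac{\pi(i)}{C_{n,p}}-1\right|\to 0\,,$$ where the supremum is over the integers $i$ in $I_n$.
   Context: For an integer $m\ge 0$ and $p\in(0,1)$, $\mathrm{Geom}(m,p)$ denotes the distribution on $\{0,\dots,m\}$ with probability mass function $\mathbb{P}(V=v)=\frac{p^v(1-p)}{1-p^{m+1}}$. For $k=2$ communities on $n$ nodes, the LECS (layerwise-exchangeable count-splitting) prior with fixed retention probability $p$ generates layers of community assignments in which, from one layer to the next, the number of nodes that leave community $r\in\{1,2\}$ (for the other community) is $V_r$, where, conditional on the current community sizes $n_1^{(\ell)}$ and $n_2^{(\ell)}=n-n_1^{(\ell)}$, the variables $V_1\sim\mathrm{Geom}(n_1^{(\ell)},p)$ and $V_2\sim\mathrm{Geom}(n_2^{(\ell)},p)$ are independent. Consequently the size of community $1$ is a Markov chain on $\{0,\dots,n\}$ that evolves by $$n_1^{(\ell+1)}=n_1^{(\ell)}-V_1+V_2\,.$$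 This chain is ergodic (irreducible and aperiodic), so it has a unique stationary distribution, denoted $\pi$. *)

theory Defs
  imports "HOL-Probability.Probability" "HOL-Library.Landau_Symbols"
begin

definition trunc_geom_mass :: "nat \<Rightarrow> real \<Rightarrow> nat \<Rightarrow> real" where
  "trunc_geom_mass m p v = (if v \<le> m then p ^ v * (1 - p) / (1 - p ^ (m + 1)) else 0)"

definition trunc_geom_pmf :: "nat \<Rightarrow> real \<Rightarrow> nat pmf" where
  "trunc_geom_pmf m p = embed_pmf (trunc_geom_mass m p)"

text \<open>\<^const>\<open>embed_pmf\<close> is only meaningful for genuine mass functions; the next lemma
  shows that this is the case for every \<open>p\<close> in the open unit interval.\<close>

lemma pmf_trunc_geom:
  assumes "0 < p" "p < 1"
  shows "pmf (trunc_geom_pmf m p) v = trunc_geom_mass m p v"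
proof -
  have lt: "p ^ (m + 1) < 1"
    using power_Suc_less_one[of p m] assms by simp
  have nonneg: "0 \<le> trunc_geom_mass m p x" for x
    using assms lt by (simp add: trunc_geom_mass_def)
  have "(\<integral>\<^sup>+x. ennreal (trunc_geom_mass m p x) \<partial>count_space UNIV)
      = (\<Sum>x\<le>m. ennreal (trunc_geom_mass m p x))"
    by (rule nn_integral_count_space') (auto simp: trunc_geom_mass_def)
  also have "\<dots> = ennreal (\<Sum>x\<le>m. trunc_geom_mass m p x)"
    using nonneg by simp
  also have "(\<Sum>x\<le>m. trunc_geom_mass m p x) = (\<Sum>x\<le>m. p ^ x) * (1 - p) / (1 - p ^ (m + 1))"
    by (simp add: trunc_geom_mass_def sum_distrib_right sum_divide_distrib)
  also have "\<dots> = 1"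
    using assms lt by (simp add: sum_gp0)
  finally show ?thesis
    unfolding trunc_geom_pmf_def by (intro pmf_embed_pmf nonneg) simp
qed

text \<open>One step of the chain of sizes of community 1, started from size \<open>i \<le> n\<close>. The subtraction
  on \<^typ>\<open>nat\<close> is exact, since \<open>v1 \<le> i\<close> on the support of \<^term>\<open>trunc_geom_pmf i p\<close>.\<close>

definition lecs_kernel :: "nat \<Rightarrow> real \<Rightarrow> nat \<Rightarrow> nat pmf" where
  "lecs_kernel n p i =
     bind_pmf (trunc_geom_pmf i p) (\<lambda>v1.
     bind_pmf (trunc_geom_pmf (n - i) p) (\<lambda>v2.
     return_pmf (i - v1 + v2)))"

definition is_lecs_stationary :: "nat \<Rightarrow> real \<Rightarrow> nat pmf \<Rightarrow> bool" where
  "is_lecs_stationary n p \<mu> \<longleftrightarrow>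
     set_pmf \<mu> \<subseteq> {0..n} \<and> bind_pmf \<mu> (lecs_kernel n p) = \<mu>"

definition lecs_stationary :: "nat \<Rightarrow> real \<Rightarrow> nat pmf" where
  "lecs_stationary n p = (THE \<mu>. is_lecs_stationary n p \<mu>)"

definition lecs_const :: "nat \<Rightarrow> real \<Rightarrow> real" where
  "lecs_const n p = inverse (\<Sum>j=0..n. (1 - p ^ (j + 1)) * (1 - p ^ (n - j + 1)))"

end

theory Submission
  imports Defs "HOL-Real_Asymp.Real_Asymp"
begin

text \<open>The chain is reversible: multiplying the transition probability from \<open>i\<close> to \<open>j\<close> by
  \<open>(1 - p\<^sup>i\<^sup>+\<^sup>1) (1 - p\<^sup>n\<^sup>-\<^sup>i\<^sup>+\<^sup>1)\<close> cancels both normalisations and leaves a sum of \<open>p\<^sup>a\<^sup>+\<^sup>b\<close> over the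
  pairs \<open>(a, b)\<close> of numbers of leaving nodes, and exchanging \<open>a\<close> and \<open>b\<close> turns it into the
  sum for the reverse transition. Hence \<open>\<pi>(i) / C\<close> is exactly
  \<open>(1 - p\<^sup>i\<^sup>+\<^sup>1) (1 - p\<^sup>n\<^sup>-\<^sup>i\<^sup>+\<^sup>1)\<close>, which differs from 1 by at most \<open>2 p\<^sup>\<eta>\<close> on \<open>[\<eta>, n - \<eta>]\<close>.\<close>

section \<open>Stationary laws of Markov kernels on a finite set\<close>

lemma pmf_bind_finite:
  assumes "finite A" "set_pmf \<mu> \<subseteq> A"
  shows "pmf (bind_pmf \<mu> K) y = (\<Sum>x\<in>A. pmf \<mu> x * pmf (K x) y)"
  unfolding pmf_bind
  by (subst integral_measure_pmf_real[OF assms(1)]) (use assms(2) in \<open>auto simp: mult.commute\<close>)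

text \<open>By balance, the total flow into \<open>y\<close> is \<open>pmf \<mu> y\<close> times the
  full mass of \<open>K y\<close>, which is 1 because \<open>K y\<close> lives on
  \<open>A\<close>.\<close>

lemma detailed_balance_imp_stationary:
  assumes fin: "finite A" and supp: "set_pmf \<mu> \<subseteq> A" and closed: "\<And>x. x \<in> A \<Longrightarrow> set_pmf (K x) \<subseteq> A"
    and balance: "\<And>x y. x \<in> A \<Longrightarrow> y \<in> A \<Longrightarrow> pmf \<mu> x * pmf (K x) y = pmf \<mu> y * pmf (K y) x"
  shows "bind_pmf \<mu> K = \<mu>"
proof (rule pmf_eqI)
  fix y
  show "pmf (bind_pmf \<mu> K) y = pmf \<mu> y"
  proof (cases "y \<in> A")
    case True
    have "pmf (bind_pmf \<mu> K) y = (\<Sum>x\<in>A. pmf \<mu> y * pmf (K y) x)"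
      using balance True by (simp add: pmf_bind_finite[OF fin supp])
    also have "\<dots> = pmf \<mu> y"
      using sum_pmf_eq_1[OF fin closed[OF True]] by (simp flip: sum_distrib_left)
    finally show ?thesis .
  next
    case False
    then have "y \<notin> set_pmf \<mu>" "y \<notin> set_pmf (bind_pmf \<mu> K)"
      using supp closed by auto
    then show ?thesis by (metis set_pmf_iff)
  qed
qed

text \<open>Subtracting from \<open>\<mu>\<close> the largest multiple of \<open>\<nu>\<close> below it leaves a nonnegative invariant
  vector that vanishes somewhere, so positivity of the kernel makes it vanish everywhere.\<close>

lemma stationary_pmf_unique:
  fixes \<mu> \<nu> :: "'a pmf"
  assumes fin: "finite A" and supp: "set_pmf \<mu> \<subseteq> A" "set_pmf \<nu> \<subseteq> A"
    and pos: "\<And>x y. x \<in> A \<Longrightarrow> y \<in> A \<Longrightarrow> pmf (K x) y > 0"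
    and stat: "bind_pmf \<mu> K = \<mu>" "bind_pmf \<nu> K = \<nu>"
  shows "\<mu> = \<nu>"
proof -
  have fin_\<nu>: "finite (set_pmf \<nu>)"
    using fin supp(2) by (rule rev_finite_subset)
  define z where "z = arg_min_on (\<lambda>x. pmf \<mu> x / pmf \<nu> x) (set_pmf \<nu>)"
  have z: "z \<in> set_pmf \<nu>"
    unfolding z_def using fin_\<nu> set_pmf_not_empty by (rule arg_min_if_finite(1))
  have zmin: "pmf \<mu> z / pmf \<nu> z \<le> pmf \<mu> x / pmf \<nu> x" if "x \<in> set_pmf \<nu>" for x
    unfolding z_def using fin_\<nu> set_pmf_not_empty that by (rule arg_min_least)
  define c where "c = pmf \<mu> z / pmf \<nu> z"
  define d where "d x = pmf \<mu> x - c * pmf \<nu> x" for x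
  have d_nonneg: "d x \<ge> 0" for x
  proof (cases "x \<in> set_pmf \<nu>")
    case True
    then show ?thesis
      using zmin[OF True] pmf_positive[OF True] by (simp add: d_def c_def pos_le_divide_eq)
  next
    case False
    then show ?thesis by (simp add: d_def set_pmf_iff)
  qed
  \<comment> \<open>By stationarity of both laws the sum is \<open>d z\<close>, and \<open>c\<close>
    was chosen so that \<open>d z = 0\<close>.\<close>
  have "(\<Sum>x\<in>A. d x * pmf (K x) z) = pmf (bind_pmf \<mu> K) z - c * pmf (bind_pmf \<nu> K) z"
    unfolding pmf_bind_finite[OF fin supp(1)] pmf_bind_finite[OF fin supp(2)]
    by (simp add: d_def left_diff_distrib mult.assoc sum_subtractf sum_distrib_left)
  also have "\<dots> = 0"
    using pmf_positive[OF z] by (simp add: stat c_def)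
  finally have "\<forall>x\<in>A. d x * pmf (K x) z = 0"
    using sum_nonneg_eq_0_iff[OF fin, of "\<lambda>x. d x * pmf (K x) z"] d_nonneg by simp
  then have d0: "d x = 0" if "x \<in> A" for x
    using pos[OF that subsetD[OF supp(2) z]] that by (metis mult_eq_0_iff less_irrefl)
  have proportional: "pmf \<mu> x = c * pmf \<nu> x" if "x \<in> A" for x
    using d0[OF that] by (simp add: d_def)
  have "(\<Sum>x\<in>A. pmf \<mu> x) = c * (\<Sum>x\<in>A. pmf \<nu> x)"
    by (simp add: proportional sum_distrib_left)
  then have "c = 1"
    by (simp add: sum_pmf_eq_1[OF fin] supp)
  show ?thesis
  proof (rule pmf_eqI)
    fix x
    show "pmf \<mu> x = pmf \<nu> x"
    proof (cases "x \<in> A")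
      case False
      then have "x \<notin> set_pmf \<mu>" "x \<notin> set_pmf \<nu>" using supp by auto
      then show ?thesis by (simp add: set_pmf_iff)
    qed (simp add: proportional \<open>c = 1\<close>)
  qed
qed

section \<open>Moves and transition probabilities of the size chain\<close>

text \<open>The product of the denominators of the two truncated geometric laws at size
  \<open>i\<close>; \<open>lecs_const\<close> is the inverse of its sum over all sizes.\<close>

definition lecs_weight :: "nat \<Rightarrow> real \<Rightarrow> nat \<Rightarrow> real" where
  "lecs_weight n p i = (1 - p ^ (i + 1)) * (1 - p ^ (n - i + 1))"

text \<open>A pair \<open>(a, b)\<close> counts the nodes leaving communities 1 and 2;
  \<open>a \<le> i\<close> keeps the subtraction exact.\<close>

definition lecs_moves :: "nat \<Rightarrow> nat \<Rightarrow> nat \<Rightarrow> (nat \<times> nat) set" where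
  "lecs_moves n i j = {(a, b). a \<le> i \<and> b \<le> n - i \<and> i - a + b = j}"

text \<open>A step is undone by sending the \<open>b\<close> arrivals back and the \<open>a\<close>
  departures home. The bounds hold since \<open>j = (i - a) + b\<close> and
  \<open>n - j = (n - i - b) + a\<close>.\<close>

lemma lecs_moves_swap:
  assumes "i \<le> n" "j \<le> n"
  shows "prod.swap ` lecs_moves n i j = lecs_moves n j i"
  using assms by (force simp: lecs_moves_def image_iff)

lemma lecs_moves_nonempty:
  assumes "i \<le> n" "j \<le> n"
  shows "lecs_moves n i j \<noteq> {}"
proof -
  \<comment> \<open>The move in one direction only: truncated subtraction makes at least one entry
    0.\<close>
  have "(i - j, j - i) \<in> lecs_moves n i j"
    using assms by (auto simp: lecs_moves_def)
  then show ?thesis by blast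
qed

lemma finite_lecs_moves: "finite (lecs_moves n i j)"
  by (rule finite_subset[of _ "{..i} \<times> {..n - i}"]) (auto simp: lecs_moves_def)

context
  fixes p :: real
  assumes p: "0 < p" "p < 1"
begin

lemma one_minus_power_pos: "0 < 1 - p ^ (m + 1)"
  using power_Suc_less_one[of p m] p by simp

lemma lecs_weight_pos: "lecs_weight n p i > 0"
  unfolding lecs_weight_def by (intro mult_pos_pos one_minus_power_pos)

lemma set_trunc_geom_pmf: "set_pmf (trunc_geom_pmf m p) \<subseteq> {..m}"
  by (auto simp: set_pmf_iff pmf_trunc_geom[OF p] trunc_geom_mass_def split: if_splits)

lemma set_lecs_kernel:
  assumes "i \<le> n"
  shows "set_pmf (lecs_kernel n p i) \<subseteq> {0..n}"
  using assms set_trunc_geom_pmf[of i] set_trunc_geom_pmf[of "n - i"]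
  by (fastforce simp: lecs_kernel_def)

lemma pmf_lecs_kernel:
  "lecs_weight n p i * pmf (lecs_kernel n p i) j
     = (1 - p)\<^sup>2 * (\<Sum>(a, b)\<in>lecs_moves n i j. p ^ (a + b))"
proof -
  let ?M = "\<lambda>a b. trunc_geom_mass i p a * trunc_geom_mass (n - i) p b"
  have "pmf (lecs_kernel n p i) j
      = (\<Sum>a\<in>{..i}. \<Sum>b\<in>{..n - i}. if i - a + b = j then ?M a b else 0)"
    unfolding lecs_kernel_def pmf_bind_finite[OF finite_atMost set_trunc_geom_pmf]
      pmf_trunc_geom[OF p] pmf_return sum_distrib_left
    by (intro sum.cong) auto
  also have "\<dots> = (\<Sum>(a, b)\<in>{..i} \<times> {..n - i}. if i - a + b = j then ?M a b else 0)"
    by (rule sum.cartesian_product)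
  also have "\<dots> = (\<Sum>(a, b)\<in>lecs_moves n i j. ?M a b)"
    by (rule sum.mono_neutral_cong_right) (auto simp: lecs_moves_def split: if_splits)
  finally have "lecs_weight n p i * pmf (lecs_kernel n p i) j
      = (\<Sum>(a, b)\<in>lecs_moves n i j. lecs_weight n p i * ?M a b)"
    by (simp add: sum_distrib_left case_prod_unfold)
  \<comment> \<open>The weight cancels both denominators, and each mass leaves one factor
    \<open>1 - p\<close>.\<close>
  also have "\<dots> = (\<Sum>(a, b)\<in>lecs_moves n i j. (1 - p)\<^sup>2 * p ^ (a + b))"
    using one_minus_power_pos[of i] one_minus_power_pos[of "n - i"]
    by (intro sum.cong) (auto simp: lecs_moves_def lecs_weight_def trunc_geom_mass_def
        power_add power2_eq_square)
  finally show ?thesis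
    by (simp add: sum_distrib_left case_prod_unfold)
qed

lemma lecs_kernel_reversible:
  assumes "i \<le> n" "j \<le> n"
  shows "lecs_weight n p i * pmf (lecs_kernel n p i) j
       = lecs_weight n p j * pmf (lecs_kernel n p j) i"
proof -
  have "(\<Sum>(a, b)\<in>lecs_moves n j i. p ^ (a + b)) = (\<Sum>(a, b)\<in>lecs_moves n i j. p ^ (a + b))"
    unfolding lecs_moves_swap[OF assms, symmetric]
    by (subst sum.reindex) (auto simp: case_prod_unfold add.commute)
  then show ?thesis
    by (simp only: pmf_lecs_kernel)
qed

text \<open>A nonempty sum of positive powers is positive. This supplies the positivity hypothesis
  of \<open>stationary_pmf_unique\<close>.\<close>

lemma pmf_lecs_kernel_pos:
  assumes "i \<le> n" "j \<le> n"
  shows "pmf (lecs_kernel n p i) j > 0"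
proof -
  have "(\<Sum>(a, b)\<in>lecs_moves n i j. p ^ (a + b)) > 0"
    using p by (intro sum_pos finite_lecs_moves lecs_moves_nonempty assms) auto
  then have "lecs_weight n p i * pmf (lecs_kernel n p i) j > 0"
    using p by (simp add: pmf_lecs_kernel)
  then show ?thesis
    using lecs_weight_pos[of n i] by (simp add: zero_less_mult_iff)
qed

section \<open>The stationary law in closed form\<close>

lemma lecs_const_pos: "lecs_const n p > 0"
proof -
  have "(\<Sum>j=0..n. lecs_weight n p j) > 0"
    by (intro sum_pos) (auto simp: lecs_weight_pos)
  then show ?thesis by (simp add: lecs_const_def lecs_weight_def)
qed

lemma lecs_stationary_exists:
  obtains \<mu> where "is_lecs_stationary n p \<mu>"
    "\<And>i. i \<le> n \<Longrightarrow> pmf \<mu> i = lecs_const n p * lecs_weight n p i"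
proof -
  \<comment> \<open>The cutoff matters: for \<open>i > n\<close> the truncated \<open>n - i\<close>
    is 0, so \<open>lecs_weight\<close> stays positive there.\<close>
  define f where "f i = (if i \<le> n then lecs_const n p * lecs_weight n p i else 0)" for i
  have f_nonneg: "0 \<le> f i" for i
    using lecs_const_pos[of n] lecs_weight_pos[of n i] by (simp add: f_def)
  have f_sum: "(\<Sum>i\<le>n. f i) = 1"
  proof -
    have "(\<Sum>i\<le>n. f i) = lecs_const n p * (\<Sum>i=0..n. lecs_weight n p i)"
      by (simp add: f_def sum_distrib_left atLeast0AtMost)
    also have "\<dots> = 1"
      using lecs_const_pos[of n] by (simp add: lecs_const_def lecs_weight_def)
    finally show ?thesis .
  qed
  have "(\<integral>\<^sup>+x. ennreal (f x) \<partial>count_space UNIV) = (\<Sum>x\<le>n. ennreal (f x))"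
    by (rule nn_integral_count_space') (auto simp: f_def)
  also have "\<dots> = 1"
    using f_nonneg f_sum by simp
  finally have pmf_f: "pmf (embed_pmf f) i = f i" for i
    by (intro pmf_embed_pmf f_nonneg)
  have supp: "set_pmf (embed_pmf f) \<subseteq> {0..n}"
    by (auto simp: set_pmf_iff pmf_f f_def split: if_splits)
  have "bind_pmf (embed_pmf f) (lecs_kernel n p) = embed_pmf f"
  proof (rule detailed_balance_imp_stationary[OF _ supp])
    show "pmf (embed_pmf f) i * pmf (lecs_kernel n p i) j
        = pmf (embed_pmf f) j * pmf (lecs_kernel n p j) i" if "i \<in> {0..n}" "j \<in> {0..n}" for i j
      using that lecs_kernel_reversible[of i n j] by (simp add: pmf_f f_def mult.assoc)
  qed (use set_lecs_kernel in auto)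
  with supp show ?thesis
    by (intro that[of "embed_pmf f"]) (auto simp: is_lecs_stationary_def pmf_f f_def)
qed

lemma pmf_lecs_stationary:
  assumes "i \<le> n"
  shows "pmf (lecs_stationary n p) i = lecs_const n p * lecs_weight n p i"
proof -
  obtain \<mu> where \<mu>: "is_lecs_stationary n p \<mu>"
    "\<And>i. i \<le> n \<Longrightarrow> pmf \<mu> i = lecs_const n p * lecs_weight n p i"
    by (rule lecs_stationary_exists[of n]) auto
  \<comment> \<open>Uniqueness makes the description by \<open>THE\<close> in
    \<open>lecs_stationary\<close> denote the explicit law \<open>\<mu>\<close>.\<close>
  have "\<nu> = \<mu>" if "is_lecs_stationary n p \<nu>" for \<nu>
  proof (rule stationary_pmf_unique)
    show "pmf (lecs_kernel n p i) j > 0" if "i \<in> {0..n}" "j \<in> {0..n}" for i j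
      using that by (simp add: pmf_lecs_kernel_pos)
  qed (use that \<mu>(1) in \<open>simp_all add: is_lecs_stationary_def\<close>)
  then have "lecs_stationary n p = \<mu>"
    unfolding lecs_stationary_def using \<mu>(1) by blast
  with \<mu>(2) assms show ?thesis by simp
qed

section \<open>Uniform deviation bound and the limit\<close>

lemma lecs_stationary_ratio_bound:
  assumes "e \<le> real i" "real i \<le> real n - e" "0 \<le> e"
  shows "\<bar>pmf (lecs_stationary n p) i / lecs_const n p - 1\<bar> \<le> 2 * p powr e"
proof -
  have pow: "p ^ (m + 1) \<le> p powr e" if "e \<le> real m" for m
  proof -
    have "p ^ (m + 1) = p powr real (m + 1)"
      using p by (simp only: powr_realpow)
    also have "\<dots> \<le> p powr e"
      using that p by (intro powr_mono') auto
    finally show ?thesis .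
  qed
  have i: "i \<le> n"
    using assms by linarith
  let ?x = "p ^ (i + 1)" and ?y = "p ^ (n - i + 1)"
  have "pmf (lecs_stationary n p) i / lecs_const n p = lecs_weight n p i"
    using lecs_const_pos[of n] by (simp add: pmf_lecs_stationary[OF i])
  \<comment> \<open>The ratio is \<open>(1 - ?x) * (1 - ?y)\<close>. As
    \<open>0 \<le> ?x * ?y \<le> ?x\<close>, the deviation lies between \<open>- ?x - ?y\<close> and
    \<open>- ?y \<le> 0\<close>.\<close>
  then have "pmf (lecs_stationary n p) i / lecs_const n p - 1 = ?x * ?y - ?x - ?y"
    by (simp add: lecs_weight_def algebra_simps)
  moreover have "0 \<le> ?x * ?y"
    using p by simp
  moreover have "?x * ?y \<le> ?x"
    using p one_minus_power_pos[of "n - i"] by (intro mult_left_le) auto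
  moreover have "0 \<le> ?y"
    using p by simp
  moreover have "?x \<le> p powr e" "?y \<le> p powr e"
    using assms i by (intro pow; simp)+
  ultimately show ?thesis
    by linarith
qed

end

theorem corollary4p2:
  fixes p :: real and \<eta> :: "nat \<Rightarrow> real"
  assumes "0 < p" and "p < 1"
    and "filterlim \<eta> at_top sequentially"
    and "\<eta> \<in> o(\<lambda>n. real n)"
  shows "(\<lambda>n. SUP i\<in>{i::nat. \<eta> n \<le> real i \<and> real i \<le> real n - \<eta> n}.
            \<bar>pmf (lecs_stationary n p) i / lecs_const n p - 1\<bar>) \<longlonglongrightarrow> 0"
proof (rule tendsto_sandwich)
  let ?I = "\<lambda>n. {i::nat. \<eta> n \<le> real i \<and> real i \<le> real n - \<eta> n}"
  let ?g = "\<lambda>n i. \<bar>pmf (lecs_stationary n p) i / lecs_const n p - 1\<bar>"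
  have ev0: "\<forall>\<^sub>F n in sequentially. 0 \<le> \<eta> n"
    using assms(3) by (simp add: filterlim_at_top)
  have ev1: "\<forall>\<^sub>F n in sequentially. norm (\<eta> n) \<le> 1/4 * norm (real n)"
    by (rule landau_o.smallD[OF assms(4)]) simp
  \<comment> \<open>The midpoint shows that the index set is eventually nonempty, as a real supremum
    requires. The factor 1/4 fits because \<open>n div 2\<close> is at least \<open>n / 4\<close>
    once \<open>n \<ge> 2\<close>.\<close>
  have ev: "\<forall>\<^sub>F n in sequentially. 0 \<le> \<eta> n \<and> n div 2 \<in> ?I n"
    using ev0 ev1 eventually_ge_at_top[of 2]
  proof eventually_elim
    case (elim n)
    have "real (n div 2) \<ge> real n / 4" "real (n div 2) \<le> real n / 2"
      using elim(3) by linarith+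
    with elim show ?case by simp
  qed
  show "\<forall>\<^sub>F n in sequentially. (SUP i\<in>?I n. ?g n i) \<le> 2 * p powr \<eta> n"
    using ev
  proof eventually_elim
    case (elim n)
    then have "?I n \<noteq> {}" by blast
    then show ?case
      using elim by (intro cSUP_least) (simp_all add: lecs_stationary_ratio_bound[OF assms(1,2)])
  qed
  show "\<forall>\<^sub>F n in sequentially. 0 \<le> (SUP i\<in>?I n. ?g n i)"
    using ev
  proof eventually_elim
    case (elim n)
    \<comment> \<open>Boundedness lets the supremum dominate the nonnegative value at the
      midpoint.\<close>
    have "bdd_above (?g n ` ?I n)"
      using elim
      by (intro bdd_aboveI2[where M = "2 * p powr \<eta> n"])
         (simp add: lecs_stationary_ratio_bound[OF assms(1,2)])
    with elim have "?g n (n div 2) \<le> (SUP i\<in>?I n. ?g n i)"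
      by (intro cSUP_upper) simp_all
    then show ?case by linarith
  qed
  have "((\<lambda>x. p powr x) \<longlongrightarrow> 0) at_top"
    using assms(1,2) by real_asymp
  then have "(\<lambda>n. p powr \<eta> n) \<longlonglongrightarrow> 0"
    using assms(3) by (rule filterlim_compose)
  then show "(\<lambda>n. 2 * p powr \<eta> n) \<longlonglongrightarrow> 0"
    by (rule tendsto_mult_right_zero)
qed simp

end
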